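(* Let $n$ be a positive integer and let $\zeta_n$ be any primitive $n$-th root of unity. For all non-negative integers $a, b$, $$z_n(\{2\}^a, 3, \{2\}^b; \zeta_n)+z_n(\{2\}^b,3,\{2\}^a; \zeta_n) =\frac{(-1)^{a+b}}{n(a+b+2)}\binom{n+a+b+1}{2(a+b)+3}(1-\zeta_n)^{2(a+b)+3}.$$
   Context: For a positive integer $k$ and a complex number $q$, $[k]_q=1+q+\cdots+q^{k-1}$ (equal to $\frac{1-q^k}{1-q}$ for $q\neq 1$). For a primitive $n$-th root of unity $\zeta_n\in\mathbb{C}$ and an $r$-tuple ${\bf s}=(s_1,\ldots,s_r)$ of positive integers, $$z_n({\bf s};\zeta_n)=z_n(s_1,\ldots,s_r;\zeta_n)=\sum_{1\le k_1<\cdots<k_r\le n-1}\ \prod_{i=1}^r\frac{\zeta_n^{(s_i-1)k_i}}{[k_i]_{\zeta_n}^{s_i}},$$ where an empty sum (the case $n-1<r$) is $0$. The symbol $\{c\}^m$ denotes $m$ consecutive copies of the entry $c$ (nothing if $m=0$), so $(\{2\}^a,3,\{2\}^b)$ is a tuple of length $a+b+1$. *)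

theory Defs
  imports Complex_Main
begin

definition primitive_root_of_unity :: "nat \<Rightarrow> complex \<Rightarrow> bool" where
  "primitive_root_of_unity n z \<longleftrightarrow> n > 0 \<and> z ^ n = 1 \<and> (\<forall>m. 0 < m \<and> m < n \<longrightarrow> z ^ m \<noteq> 1)"

definition qint :: "nat \<Rightarrow> complex \<Rightarrow> complex" where
  "qint k q = (\<Sum>j<k. q ^ j)"

definition incr_tuples :: "nat \<Rightarrow> nat \<Rightarrow> nat list set" where
  "incr_tuples n r = {ks. length ks = r \<and> sorted_wrt (<) ks \<and> set ks \<subseteq> {1..n - 1}}"

(* Intended for tuples s of positive integers (the subtraction s ! i - 1 is on nat) and for z a
   primitive n-th root of unity (so that no denominator vanishes).  Indices start at 0. *)
definition zn :: "nat \<Rightarrow> nat list \<Rightarrow> complex \<Rightarrow> complex" where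
  "zn n s z = (\<Sum>ks\<in>incr_tuples n (length s).
     \<Prod>i<length s. z ^ ((s ! i - 1) * ks ! i) / qint (ks ! i) z ^ (s ! i))"

end

theory Submission
  imports Defs "HOL-Computational_Algebra.Polynomial"
begin

text \<open>
  Put \<open>f k = \<zeta>^k / (1 - \<zeta>^k)\<^sup>2\<close> and \<open>g k = f k * \<zeta>^k / (1 - \<zeta>^k)\<close>.
  The substitution \<open>k \<mapsto> n - k\<close> fixes \<open>f\<close> and reverses the tuples, and \<open>g k + g (n - k) = - f k\<close>.
  Hence the sum of the two values is \<open>- (1 - \<zeta>)^(2m + 1)\<close> times the elementary symmetric
  function of degree \<open>m = a + b + 1\<close> in \<open>f 1, \<dots>, f (n - 1)\<close>. Under \<open>t = 2 - u - 1/u\<close> the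
  generating function factors, which gives
  \<open>n\<^sup>2 t (\<Prod>k. 1 + t * f k) = 2 - u^n - u^(-n)\<close>; the right-hand side is a polynomial in \<open>t\<close>
  of Chebyshev type, whose coefficients are explicit.
\<close>

section \<open>Increasing tuples\<close>

lemma incr_tuples_nth:
  assumes "ks \<in> incr_tuples n r" "i < r"
  shows "0 < ks ! i" "ks ! i < n"
proof -
  have "ks ! i \<in> {1..n - 1}"
    using assms nth_mem[of i ks] unfolding incr_tuples_def by blast
  then show "0 < ks ! i" "ks ! i < n" by auto
qed

text \<open>A strictly increasing tuple is determined by its set of entries, with inverse
  \<open>sorted_list_of_set\<close>. This turns the sum into an elementary symmetric
  function.\<close>

lemma sum_incr_tuples_prod:
  fixes f :: "nat \<Rightarrow> 'a::comm_semiring_1"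
  shows "(\<Sum>ks\<in>incr_tuples n r. \<Prod>i<r. f (ks ! i)) =
         (\<Sum>X | X \<subseteq> {1..n - 1} \<and> card X = r. \<Prod>x\<in>X. f x)"
proof (rule sum.reindex_bij_witness[where i = sorted_list_of_set and j = set])
  fix ks assume ks: "ks \<in> incr_tuples n r"
  then have *: "sorted_wrt (<) ks" "length ks = r" "set ks \<subseteq> {1..n - 1}"
    by (auto simp: incr_tuples_def)
  then have d: "distinct ks" "sorted ks"
    by (auto simp: strict_sorted_iff)
  then show "sorted_list_of_set (set ks) = ks"
    by (simp add: sorted_list_of_set.idem_if_sorted_distinct)
  show "set ks \<in> {X. X \<subseteq> {1..n - 1} \<and> card X = r}"
    using * d by (simp add: distinct_card)
  have "bij_betw ((!) ks) {..<r} (set ks)"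
    using bij_betw_nth[OF d(1)] * by simp
  then show "(\<Prod>x\<in>set ks. f x) = (\<Prod>i<r. f (ks ! i))"
    by (simp add: prod.reindex_bij_betw[symmetric])
next
  fix X assume X: "X \<in> {X. X \<subseteq> {1..n - 1} \<and> card X = r}"
  then have "finite X" using finite_subset by blast
  then show "set (sorted_list_of_set X) = X" "sorted_list_of_set X \<in> incr_tuples n r"
    using X by (auto simp: incr_tuples_def)
qed

text \<open>The map \<open>k\<close> to \<open>n - k\<close> permutes \<open>{1..n - 1}\<close> and
  reverses its order, so followed by \<open>rev\<close> it is an involution of the index
  set.\<close>

lemma sum_incr_tuples_reflect:
  fixes F :: "nat list \<Rightarrow> 'a::comm_monoid_add"
  shows "(\<Sum>ks\<in>incr_tuples n r. F (rev (map (\<lambda>k. n - k) ks))) = (\<Sum>ks\<in>incr_tuples n r. F ks)"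
proof -
  let ?R = "\<lambda>ks. rev (map (\<lambda>k. n - k) ks)"
  have R: "?R ks \<in> incr_tuples n r \<and> ?R (?R ks) = ks" if "ks \<in> incr_tuples n r" for ks
  proof -
    have *: "sorted_wrt (<) ks" "length ks = r" "set ks \<subseteq> {1..n - 1}"
      using that by (auto simp: incr_tuples_def)
    have "sorted_wrt (<) (?R ks)"
      unfolding sorted_wrt_rev sorted_wrt_map
      by (rule sorted_wrt_mono_rel[OF _ *(1)]) (use *(3) in fastforce)
    moreover have "set (?R ks) \<subseteq> {1..n - 1}" using *(3) by fastforce
    moreover have "?R (?R ks) = ks"
      using *(3) unfolding rev_map by (auto simp: subset_iff intro!: map_idI)
    ultimately show ?thesis using * by (simp add: incr_tuples_def)
  qed
  show ?thesis
    by (rule sum.reindex_bij_witness[of _ ?R ?R]) (use R in auto)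
qed

text \<open>Expanding the product picks \<open>1\<close> or the linear term from each factor;
  \<open>X\<close> collects the factors where the linear term is picked.\<close>

lemma coeff_prod_one_plus_linear:
  fixes f :: "'a \<Rightarrow> 'b::comm_ring_1"
  assumes "finite A"
  shows "coeff (\<Prod>x\<in>A. [:1, f x:]) m = (\<Sum>X | X \<subseteq> A \<and> card X = m. \<Prod>x\<in>X. f x)"
proof -
  have monom: "(\<Prod>x\<in>X. [:0, f x:]) = monom (\<Prod>x\<in>X. f x) (card X)" for X
    by (induction X rule: infinite_finite_induct)
       (auto simp: monom_Suc monom_0 one_pCons mult_pCons_left smult_monom)
  have "(\<Prod>x\<in>A. [:1, f x:]) = (\<Prod>x\<in>A. [:0, f x:] + 1)"
    by (simp add: one_pCons)
  also have "\<dots> = (\<Sum>X\<in>Pow A. monom (\<Prod>x\<in>X. f x) (card X))"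
    by (simp add: prod_add[OF assms] monom)
  finally have "coeff (\<Prod>x\<in>A. [:1, f x:]) m =
      (\<Sum>X\<in>Pow A. if card X = m then \<Prod>x\<in>X. f x else 0)"
    by (simp add: coeff_sum)
  also have "\<dots> = (\<Sum>X | X \<subseteq> A \<and> card X = m. \<Prod>x\<in>X. f x)"
    using assms by (intro sum.mono_neutral_cong_right) auto
  finally show ?thesis .
qed

section \<open>A polynomial of Chebyshev type\<close>

text \<open>In the variable \<open>t = 2 - u - 1/u\<close> this is \<open>2 - u^n - u^(-n)\<close>.\<close>

fun cheb :: "nat \<Rightarrow> 'a::comm_ring_1 poly" where
  "cheb 0 = 0"
| "cheb (Suc 0) = [:0, 1:]"
| "cheb (Suc (Suc n)) = [:2, -1:] * cheb (Suc n) - cheb n + [:0, 2:]"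

text \<open>The sums \<open>S n = u ^ n + v ^ n\<close> satisfy
  \<open>S (n + 2) = (u + v) * S (n + 1) - S n\<close>. With \<open>u + v = 2 - t\<close>, passing
  to \<open>2 - S n\<close> gives the recurrence of \<open>cheb\<close>, including its inhomogeneous
  term \<open>2 * t\<close>.\<close>

lemma poly_cheb:
  fixes u v :: "'a::comm_ring_1"
  assumes "u * v = 1"
  shows "poly (cheb n) (2 - u - v) = 2 - u ^ n - v ^ n"
proof (induction n rule: cheb.induct)
  case (3 n)
  have uv: "u * (v * x) = x" "v * (u * x) = x" for x
    using assms by (metis mult.assoc mult.commute mult_1)+
  have "poly (cheb (Suc (Suc n))) (2 - u - v) =
      (u + v) * poly (cheb (Suc n)) (2 - u - v) - poly (cheb n) (2 - u - v) + 2 * (2 - u - v)"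
    by (simp add: algebra_simps)
  then show ?case
    unfolding 3 by (simp add: algebra_simps uv)
qed (simp_all add: algebra_simps)

text \<open>Pascal's rule, used twice: the second difference in \<open>N\<close> lowers the bottom
  index by two.\<close>

lemma choose_second_difference:
  "(N + 2 choose (j + 2)) + (N choose (j + 2)) = 2 * (N + 1 choose (j + 2)) + (N choose j)"
  by (simp add: numeral_2_eq_2)

text \<open>The sum of two binomials makes sense over every commutative ring, and the recurrence of
  \<open>cheb\<close> acts on each summand as a second difference in \<open>n\<close>.\<close>

lemma coeff_cheb:
  "coeff (cheb n :: 'a::comm_ring_1 poly) 0 = 0 \<and>
   (\<forall>m. coeff (cheb n :: 'a poly) (Suc m) =
     (-1) ^ m * of_nat ((n + m + 1 choose (2 * m + 2)) + (n + m choose (2 * m + 2))))"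
proof (induction n rule: cheb.induct)
  case 1
  then show ?case by (simp add: binomial_eq_0)
next
  case 2
  show ?case
  proof (intro conjI allI)
    fix m show "coeff (cheb (Suc 0) :: 'a poly) (Suc m) =
      (-1) ^ m * of_nat ((Suc 0 + m + 1 choose (2 * m + 2)) + (Suc 0 + m choose (2 * m + 2)))"
      by (cases m) (simp_all add: binomial_eq_0)
  qed simp
next
  case (3 n)
  define B where "B n m = (n + m + 1 choose (2 * m + 2)) + (n + m choose (2 * m + 2))" for n m
  have IH: "coeff (cheb (Suc n) :: 'a poly) 0 = 0" "coeff (cheb n :: 'a poly) 0 = 0"
    "coeff (cheb (Suc n) :: 'a poly) (Suc m) = (-1) ^ m * of_nat (B (Suc n) m)"
    "coeff (cheb n :: 'a poly) (Suc m) = (-1) ^ m * of_nat (B n m)" for m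
    using 3 by (auto simp: B_def)
  have "coeff (cheb (Suc (Suc n)) :: 'a poly) (Suc m) = (-1) ^ m * of_nat (B (Suc (Suc n)) m)" for m
  proof (cases m)
    case 0
    \<comment> \<open>Each of the two second differences contributes \<open>1\<close>; the total
      \<open>2\<close> matches the coefficient of \<open>[:0, 2:]\<close>.\<close>
    have "B (Suc (Suc n)) 0 + B n 0 = 2 * B (Suc n) 0 + 2"
      using choose_second_difference[of "n + 1" 0] choose_second_difference[of n 0]
      by (simp add: B_def)
    then have "(of_nat (B (Suc (Suc n)) 0) :: 'a) + of_nat (B n 0) = 2 * of_nat (B (Suc n) 0) + 2"
      by (metis of_nat_add of_nat_mult of_nat_numeral)
    with 0 show ?thesis by (simp add: IH algebra_simps)
  next
    case (Suc k)
    \<comment> \<open>The term with \<open>k = m - 1\<close> comes from the \<open>-1\<close> in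
      \<open>[:2, -1:]\<close>, whose sign turns \<open>(-1) ^ k\<close> into
      \<open>(-1) ^ m\<close>.\<close>
    have "B (Suc (Suc n)) m + B n m = 2 * B (Suc n) m + B (Suc n) k"
      using choose_second_difference[of "n + m + 1" "2 * m"]
        choose_second_difference[of "n + m" "2 * m"] Suc
      by (simp add: B_def)
    then have "(of_nat (B (Suc (Suc n)) m) :: 'a) + of_nat (B n m)
        = 2 * of_nat (B (Suc n) m) + of_nat (B (Suc n) k)"
      by (metis of_nat_add of_nat_mult of_nat_numeral)
    then have B: "(of_nat (B (Suc (Suc n)) m) :: 'a)
        = 2 * of_nat (B (Suc n) m) + of_nat (B (Suc n) k) - of_nat (B n m)"
      by (simp add: algebra_simps)
    have "coeff (cheb (Suc (Suc n)) :: 'a poly) (Suc m) =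
        2 * coeff (cheb (Suc n)) (Suc m) - coeff (cheb (Suc n)) (Suc k) - coeff (cheb n) (Suc m)"
      by (simp add: Suc)
    also have "\<dots> = (-1) ^ m * of_nat (B (Suc (Suc n)) m)"
      unfolding IH B by (simp add: Suc algebra_simps)
    finally show ?thesis .
  qed
  then show ?case by (simp add: IH B_def)
qed

text \<open>The absorption identity for binomials expresses both summands of
  \<open>coeff_cheb\<close> through the single binomial
  \<open>n + m choose (2 * m + 1)\<close>.\<close>

lemma coeff_cheb_Suc:
  fixes n m :: nat
  assumes "n > 0"
  shows "coeff (cheb n :: 'a::field_char_0 poly) (Suc m) =
    (-1) ^ m * (of_nat n / of_nat (m + 1)) * of_nat (n + m choose (2 * m + 1))"
proof -
  have 1: "(2 * m + 2) * (n + m + 1 choose (2 * m + 2)) = (n + m + 1) * (n + m choose (2 * m + 1))"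
    using Suc_times_binomial[of "2 * m + 1" "n + m"] by simp
  \<comment> \<open>The factor \<open>n - m - 1\<close> is split over both sides, since it may be
    negative.\<close>
  have 2: "(2 * m + 2) * (n + m choose (2 * m + 2)) + (m + 1) * (n + m choose (2 * m + 1))
      = n * (n + m choose (2 * m + 1))"
  proof -
    have "(n + m + 1 choose (2 * m + 2)) = (n + m choose (2 * m + 1)) + (n + m choose (2 * m + 2))"
      by simp
    with 1 show ?thesis by (simp add: algebra_simps)
  qed
  have "(m + 1) * ((n + m + 1 choose (2 * m + 2)) + (n + m choose (2 * m + 2)))
      = n * (n + m choose (2 * m + 1))"
    using 1 2 by (simp add: algebra_simps)
  then have "of_nat (m + 1) * of_nat ((n + m + 1 choose (2 * m + 2)) + (n + m choose (2 * m + 2)))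
      = (of_nat n * of_nat (n + m choose (2 * m + 1)) :: 'a)"
    by (metis of_nat_mult)
  then have "of_nat ((n + m + 1 choose (2 * m + 2)) + (n + m choose (2 * m + 2)))
      = (of_nat n * of_nat (n + m choose (2 * m + 1)) / of_nat (m + 1) :: 'a)"
    by (simp add: field_simps del: of_nat_Suc of_nat_add)
  moreover have "coeff (cheb n :: 'a poly) (Suc m) =
      (-1) ^ m * of_nat ((n + m + 1 choose (2 * m + 2)) + (n + m choose (2 * m + 2)))"
    using coeff_cheb[of n] by blast
  ultimately show ?thesis by simp
qed

section \<open>Primitive roots of unity\<close>

lemma primitive_root_of_unity_power_neq_1:
  assumes "primitive_root_of_unity n z" "0 < k" "k < n"
  shows "z ^ k \<noteq> 1"
  using assms unfolding primitive_root_of_unity_def by blast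

lemma primitive_root_of_unity_nonzero:
  assumes "primitive_root_of_unity n z"
  shows "z \<noteq> 0"
  using assms unfolding primitive_root_of_unity_def by (auto simp: zero_power)

lemma inj_on_power_primitive_root:
  assumes "primitive_root_of_unity n z"
  shows "inj_on (\<lambda>k. z ^ k) {..<n}"
proof (rule linorder_inj_onI)
  fix i j assume "i < j" "i \<in> {..<n}" "j \<in> {..<n}"
  then have "z ^ (j - i) \<noteq> 1"
    using assms by (intro primitive_root_of_unity_power_neq_1) auto
  moreover have "z ^ j = z ^ i * z ^ (j - i)"
    using \<open>i < j\<close> by (simp flip: power_add)
  ultimately show "z ^ i \<noteq> z ^ j"
    using primitive_root_of_unity_nonzero[OF assms] by simp
qed auto

text \<open>Both sides are monic of degree \<open>n\<close> and vanish at the \<open>n\<close>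
  distinct powers of \<open>z\<close>.\<close>

lemma prod_primitive_root_linear:
  assumes "primitive_root_of_unity n z"
  shows "(\<Prod>k<n. [:- (z ^ k), 1:]) = monom 1 n - 1"
proof (rule poly_eqI_degree_lead_coeff[where A = "(\<lambda>k. z ^ k) ` {..<n}" and n = n])
  have n: "n > 0" "z ^ n = 1" using assms by (auto simp: primitive_root_of_unity_def)
  show "degree (\<Prod>k<n. [:- (z ^ k), 1:]) \<le> n"
    by (subst degree_prod_eq_sum_degree) auto
  have "degree (\<Prod>k<n. [:- (z ^ k), 1:]) = n"
    by (subst degree_prod_eq_sum_degree) auto
  then have "coeff (\<Prod>k<n. [:- (z ^ k), 1:]) n = 1"
    using lead_coeff_prod[of "\<lambda>k. [:- (z ^ k), 1:]" "{..<n}"] by simp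
  then show "coeff (\<Prod>k<n. [:- (z ^ k), 1:]) n = coeff (monom 1 n - 1) n"
    using n by (simp add: coeff_1)
  show "degree (monom (1::complex) n - 1) \<le> n"
    by (intro degree_diff_le degree_monom_le) auto
  show "n \<le> card ((\<lambda>k. z ^ k) ` {..<n})"
    using inj_on_power_primitive_root[OF assms] by (simp add: card_image)
  fix x assume "x \<in> (\<lambda>k. z ^ k) ` {..<n}"
  then obtain k where k: "k < n" "x = z ^ k" by auto
  have "x ^ n = 1"
    using k n by (metis mult.commute power_mult power_one)
  then show "poly (\<Prod>k<n. [:- (z ^ k), 1:]) x = poly (monom 1 n - 1) x"
    using k by (auto simp: poly_prod poly_monom prod_zero_iff)
qed

lemma prod_primitive_root_proper_linear:
  assumes "primitive_root_of_unity n z"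
  shows "[:-1, 1:] * (\<Prod>k=1..n - 1. [:- (z ^ k), 1:]) = monom 1 n - 1"
proof -
  have "n > 0" using assms by (auto simp: primitive_root_of_unity_def)
  then have "{..<n} = insert 0 {1..n - 1}" by auto
  then show ?thesis
    using prod_primitive_root_linear[OF assms] by simp
qed

text \<open>Differentiating \<open>(x - 1) * Q = x ^ n - 1\<close> at \<open>x = 1\<close> gives
  \<open>Q 1 = n\<close> without a division of polynomials.\<close>

lemma prod_one_minus_primitive_root:
  assumes "primitive_root_of_unity n z"
  shows "(\<Prod>k=1..n - 1. 1 - z ^ k) = of_nat n"
proof -
  let ?Q = "\<Prod>k=1..n - 1. [:- (z ^ k), 1:]"
  have "poly (pderiv ([:-1, 1:] * ?Q)) 1 = poly (pderiv (monom 1 n - 1)) 1"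
    by (simp only: prod_primitive_root_proper_linear[OF assms])
  then have "poly ?Q 1 = of_nat n"
    unfolding pderiv_mult by (simp add: pderiv_diff pderiv_monom poly_monom pderiv_pCons)
  then show ?thesis by (simp add: poly_prod)
qed

section \<open>The elementary symmetric functions\<close>

definition sq_weight :: "complex \<Rightarrow> nat \<Rightarrow> complex" where
  "sq_weight z k = z ^ k / (1 - z ^ k) ^ 2"

text \<open>The reflection replaces \<open>x = z ^ k\<close> by \<open>1 / x\<close>, which leaves
  \<open>x / (1 - x) ^ 2\<close> invariant and sends \<open>x / (1 - x)\<close> to
  \<open>- 1 / (1 - x)\<close>.\<close>

lemma sq_weight_reflect:
  assumes "primitive_root_of_unity n z" "0 < k" "k < n"
  shows "sq_weight z (n - k) = sq_weight z k"
    and "z ^ (n - k) / (1 - z ^ (n - k)) = - 1 / (1 - z ^ k)"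
proof -
  have x: "z ^ k \<noteq> 0" "z ^ k \<noteq> 1" "z ^ (n - k) = 1 / z ^ k"
    using assms primitive_root_of_unity_power_neq_1[OF assms]
      primitive_root_of_unity_nonzero[OF assms(1)]
    by (auto simp: power_diff primitive_root_of_unity_def)
  then show "sq_weight z (n - k) = sq_weight z k"
    unfolding sq_weight_def x by (simp add: divide_simps) (simp add: power2_eq_square algebra_simps)
  show "z ^ (n - k) / (1 - z ^ (n - k)) = - 1 / (1 - z ^ k)"
    using x unfolding x by (simp add: divide_simps)
qed

lemma ex_two_minus_add_inverse:
  fixes t :: complex
  obtains u v where "u * v = 1" "t = 2 - u - v"
proof
  \<comment> \<open>The witnesses are the two roots of
    \<open>X ^ 2 - (2 - t) * X + 1\<close>.\<close>
  let ?s = "csqrt ((2 - t) ^ 2 - 4)"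
  have "((2 - t + ?s) / 2) * ((2 - t - ?s) / 2) = ((2 - t) ^ 2 - ?s ^ 2) / 4"
    by (simp add: power2_eq_square algebra_simps)
  then show "((2 - t + ?s) / 2) * ((2 - t - ?s) / 2) = 1" by simp
  show "t = 2 - (2 - t + ?s) / 2 - (2 - t - ?s) / 2"
    by (simp add: field_simps)
qed

lemma prod_one_plus_sq_weight:
  assumes "primitive_root_of_unity n z"
  shows "smult (of_nat n ^ 2) (pCons 0 (\<Prod>k=1..n - 1. [:1, sq_weight z k:])) = cheb n"
proof -
  have "poly (smult (of_nat n ^ 2) (pCons 0 (\<Prod>k=1..n - 1. [:1, sq_weight z k:]))) t
      = poly (cheb n) t" for t
  proof -
    obtain u v where uv: "u * v = 1" "t = 2 - u - v" by (rule ex_two_minus_add_inverse)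
    have ev: "(x - 1) * (\<Prod>k=1..n - 1. x - z ^ k) = x ^ n - 1" for x
      using arg_cong[OF prod_primitive_root_proper_linear[OF assms], of "\<lambda>p. poly p x"]
      by (simp add: poly_prod poly_monom algebra_simps)
    have factor: "(1 - z ^ k) ^ 2 * (1 + t * sq_weight z k) = (u - z ^ k) * (v - z ^ k)"
      if "k \<in> {1..n - 1}" for k
    proof -
      have "z ^ k \<noteq> 1"
        using that by (intro primitive_root_of_unity_power_neq_1[OF assms]) auto
      then have "(1 - z ^ k) ^ 2 * (1 + t * sq_weight z k) = (1 - z ^ k) ^ 2 + t * z ^ k"
        by (simp add: sq_weight_def field_simps)
      \<comment> \<open>Since \<open>u * v = 1\<close>, both sides equal
        \<open>1 - (u + v) * x + x ^ 2\<close> with \<open>x = z ^ k\<close>.\<close>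
      also have "\<dots> = (u - z ^ k) * (v - z ^ k)"
        using uv(1) unfolding uv(2) by (simp add: power2_eq_square algebra_simps)
      finally show ?thesis .
    qed
    have "of_nat n ^ 2 * (\<Prod>k=1..n - 1. 1 + t * sq_weight z k)
        = (\<Prod>k=1..n - 1. (1 - z ^ k) ^ 2 * (1 + t * sq_weight z k))"
      by (simp only: prod.distrib prod_power_distrib[symmetric] prod_one_minus_primitive_root[OF assms])
    also have "\<dots> = (\<Prod>k=1..n - 1. u - z ^ k) * (\<Prod>k=1..n - 1. v - z ^ k)"
      by (simp add: factor prod.distrib)
    finally have prod: "of_nat n ^ 2 * (\<Prod>k=1..n - 1. 1 + t * sq_weight z k)
        = (\<Prod>k=1..n - 1. u - z ^ k) * (\<Prod>k=1..n - 1. v - z ^ k)" .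
    \<comment> \<open>The extra factor \<open>t\<close> supplies the missing root \<open>1\<close>
      in both products, completing them to \<open>u ^ n - 1\<close> and
      \<open>v ^ n - 1\<close>.\<close>
    have "t = (u - 1) * (v - 1)"
      using uv by (simp add: algebra_simps)
    then have "t * (of_nat n ^ 2 * (\<Prod>k=1..n - 1. 1 + t * sq_weight z k))
        = ((u - 1) * (\<Prod>k=1..n - 1. u - z ^ k)) * ((v - 1) * (\<Prod>k=1..n - 1. v - z ^ k))"
      unfolding prod by (simp only: mult_ac)
    also have "\<dots> = (u ^ n - 1) * (v ^ n - 1)" by (simp only: ev)
    also have "\<dots> = 2 - u ^ n - v ^ n"
      using uv(1) by (simp add: algebra_simps flip: power_mult_distrib)
    finally show ?thesis
      using poly_cheb[OF uv(1), of n] uv(2) by (simp add: poly_prod mult_ac)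
  qed
  then show ?thesis by (simp flip: poly_eq_poly_eq_iff add: fun_eq_iff)
qed

text \<open>Comparison of the coefficients of degree \<open>m + 1\<close> in
  \<open>prod_one_plus_sq_weight\<close>; the shift by one comes from the
  \<open>pCons 0\<close>.\<close>

lemma sum_incr_tuples_sq_weight:
  assumes "primitive_root_of_unity n z"
  shows "(\<Sum>ks\<in>incr_tuples n m. \<Prod>i<m. sq_weight z (ks ! i)) =
    (-1) ^ m / (of_nat n * of_nat (m + 1)) * of_nat (n + m choose (2 * m + 1))"
proof -
  have n: "n > 0" using assms by (auto simp: primitive_root_of_unity_def)
  have "of_nat n ^ 2 * (\<Sum>ks\<in>incr_tuples n m. \<Prod>i<m. sq_weight z (ks ! i))
      = coeff (cheb n) (Suc m)"
    by (simp add: sum_incr_tuples_prod coeff_prod_one_plus_linear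
        flip: prod_one_plus_sq_weight[OF assms])
  then show ?thesis
    using n unfolding coeff_cheb_Suc[OF n]
    by (simp add: divide_simps power2_eq_square del: of_nat_add of_nat_Suc) (simp add: mult_ac)
qed

section \<open>The symmetric sum\<close>

text \<open>Since \<open>qint k z = (1 - z ^ k) / (1 - z)\<close>, an entry 2 contributes
  \<open>(1 - z) ^ 2 * sq_weight z k\<close>, and the entry 3 at index \<open>a\<close> has the
  further factor \<open>(1 - z) * z ^ k / (1 - z ^ k)\<close>.\<close>

lemma zn_twos_three_twos:
  assumes "primitive_root_of_unity n z"
  shows "zn n (replicate a 2 @ [3] @ replicate b 2) z = (1 - z) ^ (2 * (a + b) + 3) *
    (\<Sum>ks\<in>incr_tuples n (Suc (a + b)).
      (z ^ (ks ! a) / (1 - z ^ (ks ! a))) * (\<Prod>i<Suc (a + b). sq_weight z (ks ! i)))"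
proof -
  let ?s = "replicate a 2 @ [3] @ replicate b 2 :: nat list"
  have len: "length ?s = Suc (a + b)" by simp
  have s: "?s ! i = (if i = a then 3 else 2)" if "i < Suc (a + b)" for i
    using that by (auto simp: nth_append nth_Cons')
  have "(\<Prod>i<Suc (a + b). z ^ ((?s ! i - 1) * ks ! i) / qint (ks ! i) z ^ (?s ! i)) =
      (1 - z) ^ (2 * (a + b) + 3) *
      ((z ^ (ks ! a) / (1 - z ^ (ks ! a))) * (\<Prod>i<Suc (a + b). sq_weight z (ks ! i)))"
    if ks: "ks \<in> incr_tuples n (Suc (a + b))" for ks
  proof -
    have "z ^ ((?s ! i - 1) * ks ! i) / qint (ks ! i) z ^ (?s ! i) =
        (1 - z) ^ 2 * sq_weight z (ks ! i) *
        (if i = a then (1 - z) * (z ^ (ks ! a) / (1 - z ^ (ks ! a))) else 1)"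
      if i: "i < Suc (a + b)" for i
    proof -
      have k: "0 < ks ! i" "ks ! i < n" using incr_tuples_nth[OF ks i] by auto
      have x: "z ^ (ks ! i) \<noteq> 1" "z \<noteq> 1"
        using primitive_root_of_unity_power_neq_1[OF assms k] by auto
      then have q: "qint (ks ! i) z = (1 - z ^ (ks ! i)) / (1 - z)"
        by (simp add: qint_def sum_gp_strict)
      show ?thesis
        using x unfolding s[OF i] q sq_weight_def
        by (auto simp: power_mult power_divide power_mult_distrib mult_ac power2_eq_square power3_eq_cube)
    qed
    then have "(\<Prod>i<Suc (a + b). z ^ ((?s ! i - 1) * ks ! i) / qint (ks ! i) z ^ (?s ! i)) =
        (\<Prod>i<Suc (a + b). (1 - z) ^ 2 * sq_weight z (ks ! i) *
          (if i = a then (1 - z) * (z ^ (ks ! a) / (1 - z ^ (ks ! a))) else 1))"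
      by (intro prod.cong) auto
    also have "\<dots> = ((1 - z) ^ 2) ^ Suc (a + b) * (\<Prod>i<Suc (a + b). sq_weight z (ks ! i)) *
          ((1 - z) * (z ^ (ks ! a) / (1 - z ^ (ks ! a))))"
      by (simp only: prod.distrib prod_constant card_lessThan prod.delta finite_lessThan) simp
    also have "\<dots> = (((1 - z) ^ 2) ^ Suc (a + b) * (1 - z)) *
          ((z ^ (ks ! a) / (1 - z ^ (ks ! a))) * (\<Prod>i<Suc (a + b). sq_weight z (ks ! i)))"
      by (simp only: mult_ac)
    also have "((1 - z) ^ 2) ^ Suc (a + b) * (1 - z) = (1 - z) ^ (2 * (a + b) + 3)"
      unfolding power_mult[symmetric] power_Suc2[symmetric]
      by (rule arg_cong[where f = "\<lambda>k. (1 - z) ^ k"]) simp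
    finally show ?thesis .
  qed
  then show ?thesis
    unfolding zn_def len sum_distrib_left by (intro sum.cong) auto
qed

theorem theorem1p1:
  fixes n a b :: nat and \<zeta> :: complex
  assumes "n > 0" and "primitive_root_of_unity n \<zeta>"
  shows "zn n (replicate a 2 @ [3] @ replicate b 2) \<zeta>
           + zn n (replicate b 2 @ [3] @ replicate a 2) \<zeta>
         = (-1) ^ (a + b) / (of_nat n * of_nat (a + b + 2))
             * of_nat ((n + a + b + 1) choose (2 * (a + b) + 3))
             * (1 - \<zeta>) ^ (2 * (a + b) + 3)"
proof -
  let ?m = "Suc (a + b)"
  let ?w = "(1 - \<zeta>) ^ (2 * (a + b) + 3)"
  let ?T = "incr_tuples n ?m"
  let ?P = "\<lambda>ks. \<Prod>i<?m. sq_weight \<zeta> (ks ! i)"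
  let ?h = "\<lambda>k. \<zeta> ^ k / (1 - \<zeta> ^ k)"
  \<comment> \<open>Tuples have length \<open>a + b + 1\<close>, so reversal exchanges the indices
    \<open>a\<close> and \<open>b\<close>; both sums then single out the entry
    \<open>ks ! a\<close>.\<close>
  have reflect: "?h (rev (map (\<lambda>k. n - k) ks) ! b) * ?P (rev (map (\<lambda>k. n - k) ks))
      = - 1 / (1 - \<zeta> ^ (ks ! a)) * ?P ks" if ks: "ks \<in> ?T" for ks
  proof -
    have len: "length ks = ?m" using ks by (simp add: incr_tuples_def)
    have nth: "rev (map (\<lambda>k. n - k) ks) ! i = n - ks ! (a + b - i)" if "i < ?m" for i
      using that len by (simp add: rev_nth)
    have "?P (rev (map (\<lambda>k. n - k) ks)) = (\<Prod>i<?m. sq_weight \<zeta> (ks ! (a + b - i)))"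
    proof (intro prod.cong refl)
      fix i assume "i \<in> {..<?m}"
      then show "sq_weight \<zeta> (rev (map (\<lambda>k. n - k) ks) ! i) = sq_weight \<zeta> (ks ! (a + b - i))"
        using incr_tuples_nth[OF ks, of "a + b - i"] nth[of i] assms(2)
        by (simp add: sq_weight_reflect)
    qed
    also have "\<dots> = ?P ks"
      using prod.nat_diff_reindex[of "\<lambda>i. sq_weight \<zeta> (ks ! i)" ?m] by simp
    finally show ?thesis
      using nth[of b] incr_tuples_nth[OF ks, of a] sq_weight_reflect(2)[OF assms(2), of "ks ! a"]
      by simp
  qed
  have "zn n (replicate b 2 @ [3] @ replicate a 2) \<zeta> = ?w * (\<Sum>ks\<in>?T. ?h (ks ! b) * ?P ks)"
    using zn_twos_three_twos[OF assms(2), of b a] by (simp only: add.commute[of b a])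
  also have "(\<Sum>ks\<in>?T. ?h (ks ! b) * ?P ks) = (\<Sum>ks\<in>?T. - 1 / (1 - \<zeta> ^ (ks ! a)) * ?P ks)"
    unfolding sum_incr_tuples_reflect[of "\<lambda>ks. ?h (ks ! b) * ?P ks", symmetric]
    by (intro sum.cong refl reflect)
  finally have "zn n (replicate a 2 @ [3] @ replicate b 2) \<zeta>
      + zn n (replicate b 2 @ [3] @ replicate a 2) \<zeta>
      = ?w * (\<Sum>ks\<in>?T. ?h (ks ! a) * ?P ks + - 1 / (1 - \<zeta> ^ (ks ! a)) * ?P ks)"
    unfolding zn_twos_three_twos[OF assms(2), of a b] sum.distrib by (simp only: distrib_left)
  \<comment> \<open>As \<open>x / (1 - x) - 1 / (1 - x) = - 1\<close>, the dependence on the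
    position \<open>a\<close> disappears and only a symmetric function remains.\<close>
  also have "(\<Sum>ks\<in>?T. ?h (ks ! a) * ?P ks + - 1 / (1 - \<zeta> ^ (ks ! a)) * ?P ks) = (\<Sum>ks\<in>?T. - ?P ks)"
  proof (intro sum.cong refl)
    fix ks assume ks: "ks \<in> ?T"
    then have "\<zeta> ^ (ks ! a) \<noteq> 1"
      using incr_tuples_nth[OF ks, of a] primitive_root_of_unity_power_neq_1[OF assms(2)] by simp
    then have "?h (ks ! a) + - 1 / (1 - \<zeta> ^ (ks ! a)) = - 1"
      by (simp add: divide_simps)
    then show "?h (ks ! a) * ?P ks + - 1 / (1 - \<zeta> ^ (ks ! a)) * ?P ks = - ?P ks"
      by (metis distrib_right mult_minus1)
  qed
  also have "(\<Sum>ks\<in>?T. - ?P ks) = - ((-1) ^ ?m / (of_nat n * of_nat (?m + 1))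
      * of_nat (n + ?m choose (2 * ?m + 1)))"
    unfolding sum_negf sum_incr_tuples_sq_weight[OF assms(2)] ..
  finally have "zn n (replicate a 2 @ [3] @ replicate b 2) \<zeta>
      + zn n (replicate b 2 @ [3] @ replicate a 2) \<zeta>
      = ?w * - ((-1) ^ ?m / (of_nat n * of_nat (?m + 1)) * of_nat (n + ?m choose (2 * ?m + 1)))" .
  \<comment> \<open>The outer minus sign is absorbed by \<open>(-1) ^ ?m\<close>, leaving the
    exponent \<open>a + b\<close>.\<close>
  moreover have "n + ?m = n + a + b + 1" "2 * ?m + 1 = 2 * (a + b) + 3" "?m + 1 = a + b + 2"
    by simp_all
  ultimately show ?thesis
    by (simp only:) simp
qed

end
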